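(* Let $(\Omega, \mathcal{F}, (\mathcal{F}_t)_{t \geq 0}, \mathbb{P})$ be a stochastic basis, let $\mathbb{D}$ denote the set of (real-valued) adapted càdlàg processes on it, and let $H^n \in \mathbb{D}$ for $n \in \mathbb{N}$ and $H \in \mathbb{D}$. The following statements are equivalent: (i) $H^n \to H$ uniformly on compacts in probability (ucp) as $n \to \infty$. (ii) For every subsequence $(n_k)_{k \in \mathbb{N}}$ of $\mathbb{N}$ there exists a subsubsequence $(n_{k_l})_{l \in \mathbb{N}}$ of $(n_k)_{k\in\mathbb{N}}$ such that $H^{n_{k_l}}$ converges pre-locally to $H$ in $\underline{\underline{S}}^2$ as $l \to \infty$.
   Context: A stochastic basis is a filtered probability space whose filtration satisfies the usual hypotheses (the filtration is right-continuous and $\mathcal{F}_0$ contains all $\mathbb{P}$-null sets of the complete $\sigma$-algebra $\mathcal{F}$). Processes are indexed by $t \in [0,\infty)$. Ucp convergence: a sequence $(H^n)_{n\in\mathbb{N}}$ of processes converges uniformly on compacts in probability (ucp) to a process $H$ if for every $t > 0$, $\sup_{0 \leq s \leq t} |H^n_s - H_s| \to 0$ in probability as $n \to \infty$. $\underline{\underline{S}}^2$-norm: for a càdlàg process $H$, $\|H\|_{\underline{\underline{S}}^2} := \big\| \sup_{t \geq 0} |H_t| \big\|_{L^2} \in [0,\infty]$. Process stopped just before $T$: for a càdlàg process $X$ and a stopping time $T$ with values in $[0,\infty]$, $X^{T-}$ is the process $X^{T-}_t := X_t \mathbf{1}_{\{t < T\}} + X_{T-} \mathbf{1}_{\{t \geq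 T\}}$, where $X_{T-}$ is the left limit of $X$ at $T$, with the convention $X_{0-} := 0$. Pre-local convergence in $\underline{\underline{S}}^2$: a sequence $(X^l)_{l \in \mathbb{N}}$ in $\mathbb{D}$ converges pre-locally to $X \in \mathbb{D}$ in $\underline{\underline{S}}^2$ if there exists a nondecreasing sequence of stopping times $(T_m)_{m \in \mathbb{N}}$ with $T_m \to \infty$ almost surely as $m \to \infty$ such that for every $m \in \mathbb{N}$, $\lim_{l \to \infty} \| (X^l - X)^{T_m-} \|_{\underline{\underline{S}}^2} = 0$. Subsequences are given by strictly increasing sequences of indices. *)

theory Defs
  imports "HOL-Probability.Probability"
begin

text \<open>
  Time is the half-line \<open>[0, \<infinity>)\<close>, rendered as the type \<^typ>\<open>real\<close> with guards \<open>0 \<le> t\<close>: the values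
  of filtrations and processes at negative times are never used.  Only the \<open>\<sigma>\<close>-algebra of \<open>F t\<close>
  matters, not its measure.  Stopping times take values in \<open>[0, \<infinity>]\<close>, i.e. in \<^typ>\<open>ennreal\<close>.
\<close>

locale stochastic_basis = prob_space M + complete_measure M
  for M :: "'a measure" +
  fixes F :: "real \<Rightarrow> 'a measure"
  assumes subalgebra_F: "0 \<le> t \<Longrightarrow> subalgebra M (F t)"
    and F_mono: "0 \<le> s \<Longrightarrow> s \<le> t \<Longrightarrow> sets (F s) \<subseteq> sets (F t)"
    and F_right_continuous: "0 \<le> t \<Longrightarrow> (\<Inter>u\<in>{t<..}. sets (F u)) = sets (F t)"
    and null_sets_F: "null_sets M \<subseteq> sets (F 0)"

definition cadlag :: "(real \<Rightarrow> real) \<Rightarrow> bool" where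
  "cadlag f \<longleftrightarrow> (\<forall>t\<ge>0. continuous (at_right t) f) \<and> (\<forall>t>0. \<exists>l. (f \<longlongrightarrow> l) (at_left t))"

definition adapted_cadlag :: "'a measure \<Rightarrow> (real \<Rightarrow> 'a measure) \<Rightarrow> (real \<Rightarrow> 'a \<Rightarrow> real) set" where
  "adapted_cadlag M F = {X. (\<forall>t\<ge>0. X t \<in> borel_measurable (F t)) \<and>
                            (\<forall>\<omega>\<in>space M. cadlag (\<lambda>t. X t \<omega>))}"

definition extended_stopping_time :: "(real \<Rightarrow> 'a measure) \<Rightarrow> ('a \<Rightarrow> ennreal) \<Rightarrow> bool" where
  "extended_stopping_time F T \<longleftrightarrow> (\<forall>t\<ge>0. Measurable.pred (F t) (\<lambda>\<omega>. T \<omega> \<le> ennreal t))"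

text \<open>
  The library predicate \<^const>\<open>stopping_time\<close> requires the filtration to be indexed by the type of
  values of the stopping time.  The definition above agrees with it once the filtration is extended
  by \<open>F \<infinity> = M\<close> (any other choice of \<open>F \<infinity>\<close> would do).
\<close>

definition extend_filtration :: "'a measure \<Rightarrow> (real \<Rightarrow> 'a measure) \<Rightarrow> ennreal \<Rightarrow> 'a measure" where
  "extend_filtration M F t = (if t = \<infinity> then M else F (enn2real t))"

lemma extended_stopping_time_iff:
  "extended_stopping_time F T \<longleftrightarrow> stopping_time (extend_filtration M F) T"
proof
  assume T: "extended_stopping_time F T"
  show "stopping_time (extend_filtration M F) T"
  proof
    fix t :: ennreal
    show "Measurable.pred (extend_filtration M F t) (\<lambda>x. T x \<le> t)"
      using T by (cases t) (auto simp: extended_stopping_time_def extend_filtration_def)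
  qed
next
  assume T: "stopping_time (extend_filtration M F) T"
  show "extended_stopping_time F T"
    unfolding extended_stopping_time_def
  proof (intro allI impI)
    fix t :: real assume "0 \<le> t"
    then show "Measurable.pred (F t) (\<lambda>\<omega>. T \<omega> \<le> ennreal t)"
      using stopping_timeD[OF T, of "ennreal t"] by (simp add: extend_filtration_def)
  qed
qed

lemma (in stochastic_basis) filtration_extend_filtration:
  "filtration (space M) (extend_filtration M F)"
proof
  fix s t :: ennreal
  show "space (extend_filtration M F t) = space M"
    using subalgebra_F[of "enn2real t"] by (auto simp: extend_filtration_def subalgebra_def)
  assume "s \<le> t"
  then show "sets (extend_filtration M F s) \<subseteq> sets (extend_filtration M F t)"
    using subalgebra_F[of "enn2real s"] F_mono[of "enn2real s" "enn2real t"]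
    by (auto simp: extend_filtration_def subalgebra_def enn2real_mono top.not_eq_extremum top.extremum_unique)
qed

text \<open>
  Suprema are taken in \<^typ>\<open>ennreal\<close>, where they always exist; over compact intervals they are finite
  for processes with cadlag paths.
\<close>

definition ucp_tendsto ::
    "'a measure \<Rightarrow> (nat \<Rightarrow> real \<Rightarrow> 'a \<Rightarrow> real) \<Rightarrow> (real \<Rightarrow> 'a \<Rightarrow> real) \<Rightarrow> bool" where
  "ucp_tendsto M H K \<longleftrightarrow> (\<forall>t>0. \<forall>\<epsilon>>0.
     (\<lambda>n. measure M {\<omega>\<in>space M. ennreal \<epsilon> < (SUP s\<in>{0..t}. ennreal \<bar>H n s \<omega> - K s \<omega>\<bar>)})
       \<longlonglongrightarrow> 0)"

definition L2_norm :: "'a measure \<Rightarrow> ('a \<Rightarrow> ennreal) \<Rightarrow> ennreal" where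
  "L2_norm M Y = (let I = \<integral>\<^sup>+\<omega>. (Y \<omega>)\<^sup>2 \<partial>M in if I = \<infinity> then \<infinity> else ennreal (sqrt (enn2real I)))"

definition S2_norm :: "'a measure \<Rightarrow> (real \<Rightarrow> 'a \<Rightarrow> real) \<Rightarrow> ennreal" where
  "S2_norm M X = L2_norm M (\<lambda>\<omega>. SUP t\<in>{0..}. ennreal \<bar>X t \<omega>\<bar>)"

definition left_limit :: "(real \<Rightarrow> real) \<Rightarrow> real \<Rightarrow> real" where
  "left_limit f t = (if t = 0 then 0 else Lim (at_left t) f)"

text \<open>In the second branch \<open>T \<omega> \<le> t < \<infinity>\<close>, so \<open>enn2real (T \<omega>)\<close> is the true value of \<open>T \<omega>\<close>.\<close>

definition stopped_before ::
    "(real \<Rightarrow> 'a \<Rightarrow> real) \<Rightarrow> ('a \<Rightarrow> ennreal) \<Rightarrow> real \<Rightarrow> 'a \<Rightarrow> real" where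
  "stopped_before X T t \<omega> =
     (if ennreal t < T \<omega> then X t \<omega> else left_limit (\<lambda>s. X s \<omega>) (enn2real (T \<omega>)))"

definition prelocal_S2_tendsto ::
    "'a measure \<Rightarrow> (real \<Rightarrow> 'a measure) \<Rightarrow> (nat \<Rightarrow> real \<Rightarrow> 'a \<Rightarrow> real) \<Rightarrow> (real \<Rightarrow> 'a \<Rightarrow> real) \<Rightarrow> bool"
where
  "prelocal_S2_tendsto M F X Y \<longleftrightarrow>
     (\<exists>T :: nat \<Rightarrow> 'a \<Rightarrow> ennreal.
        (\<forall>m. extended_stopping_time F (T m)) \<and>
        (\<forall>\<omega>\<in>space M. incseq (\<lambda>m. T m \<omega>)) \<and>
        (AE \<omega> in M. (\<lambda>m. T m \<omega>) \<longlonglongrightarrow> \<infinity>) \<and>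
        (\<forall>m. (\<lambda>l. S2_norm M (stopped_before (\<lambda>t \<omega>. X l t \<omega> - Y t \<omega>) (T m))) \<longlonglongrightarrow> 0))"

end

theory Submission
  imports Defs "HOL-Real_Asymp.Real_Asymp"
begin

text \<open>
  Let \<open>X l\<close> be the \<open>l\<close>-th process minus the limit.  Under ucp convergence we may pass to a
  subsequence with \<open>P (sup\<^bsub>t \<le> l\<^esub> \<bar>X l t\<bar> > 2\<^sup>-\<^sup>l) \<le> 2\<^sup>-\<^sup>l\<close>.  Let \<open>T m\<close> be the first time at which some \<open>X l\<close> with
  \<open>l \<ge> m\<close> exceeds \<open>2\<^sup>-\<^sup>l\<close> in absolute value.  This is a stopping time because the filtration is
  right-continuous, it tends to infinity by the Borel-Cantelli lemma, and strictly before \<open>T m\<close>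
  the process \<open>X l\<close> is bounded by \<open>2\<^sup>-\<^sup>l\<close>.  Conversely, on the event \<open>t < T m\<close> the process and the
  stopped process coincide on \<open>[0, t]\<close>, so Chebyshev's inequality gives convergence
  in probability along a subsubsequence of every subsequence, hence along the whole sequence.
\<close>

section \<open>Extraction of subsequences\<close>

lemma tendsto_if_subsubseq_tendsto:
  fixes f :: "nat \<Rightarrow> 'b::topological_space"
  assumes "\<And>r :: nat \<Rightarrow> nat. strict_mono r \<Longrightarrow> \<exists>s :: nat \<Rightarrow> nat. (\<lambda>l. f (r (s l))) \<longlonglongrightarrow> a"
  shows "f \<longlonglongrightarrow> a"
proof (rule ccontr)
  assume "\<not> f \<longlonglongrightarrow> a"
  then obtain S where S: "open S" "a \<in> S" "\<not> eventually (\<lambda>n. f n \<in> S) sequentially"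
    unfolding tendsto_def by blast
  \<comment> \<open>Divergence leaves infinitely many indices outside \<open>S\<close>. Enumerating
    them yields a subsequence that avoids \<open>S\<close> entirely, so no reindexing of it can tend
    to \<open>a\<close>.\<close>
  then have "infinite {n. f n \<notin> S}"
    by (simp add: eventually_cofinite flip: cofinite_eq_sequentially)
  then obtain r :: "nat \<Rightarrow> nat" where r: "strict_mono r" "\<And>n. f (r n) \<notin> S"
    using infinite_enumerate[of "{n. f n \<notin> S}"] by auto
  obtain s :: "nat \<Rightarrow> nat" where "(\<lambda>l. f (r (s l))) \<longlonglongrightarrow> a"
    using assms[OF r(1)] by blast
  then have "eventually (\<lambda>l. f (r (s l)) \<in> S) sequentially"
    using S(1,2) by (rule topological_tendstoD)
  then show False
    using r(2) by simp
qed

text \<open>Since every \<open>Q l\<close> holds for all large indices, \<open>s (Suc l)\<close> can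
  always be picked beyond \<open>s l\<close>. This extracts a subsequence whose \<open>l\<close>-th
  member meets the \<open>l\<close>-th requirement.\<close>

lemma strict_mono_choice:
  fixes Q :: "nat \<Rightarrow> nat \<Rightarrow> bool"
  assumes "\<And>l. eventually (Q l) sequentially"
  obtains s :: "nat \<Rightarrow> nat" where "strict_mono s" "\<And>l. Q l (s l)"
proof -
  have "\<exists>s. \<forall>l. Q l (s l) \<and> s l < s (Suc l)"
  proof (rule dependent_nat_choice)
    show "\<exists>n. Q 0 n"
      using assms[of 0] by (auto simp: eventually_sequentially)
    show "\<exists>k. Q (Suc l) k \<and> n < k" for n l
      using eventually_conj[OF assms[of "Suc l"] eventually_gt_at_top[of n]]
      by (auto simp: eventually_sequentially)
  qed
  then show ?thesis
    using that by (auto simp: strict_mono_Suc_iff)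
qed

section \<open>Cadlag paths and stopping just before a time\<close>

lemma cadlag_diff:
  assumes "cadlag f" "cadlag g"
  shows "cadlag (\<lambda>t. f t - g t)"
  using assms unfolding cadlag_def by (auto intro!: continuous_diff) (metis tendsto_diff)

text \<open>By right-continuity a strict exceedance at \<open>s\<close> persists on a short interval
  to the right of \<open>s\<close>, and that interval contains a rational. This turns conditions
  over uncountably many times into countable ones.\<close>

lemma cadlag_exceeds_at_rational:
  assumes f: "cadlag f" and s: "0 \<le> s" "s < v" "c < \<bar>f s\<bar>"
  shows "\<exists>q\<in>\<rat>. s < q \<and> q < v \<and> c < \<bar>f q\<bar>"
proof -
  have "((\<lambda>t. \<bar>f t\<bar>) \<longlongrightarrow> \<bar>f s\<bar>) (at_right s)"
    using f s(1) by (intro tendsto_rabs) (auto simp: cadlag_def continuous_within)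
  then have "eventually (\<lambda>t. c < \<bar>f t\<bar>) (at_right s)"
    using s(3) by (rule order_tendstoD)
  then obtain b where b: "s < b" "\<And>t. s < t \<Longrightarrow> t < b \<Longrightarrow> c < \<bar>f t\<bar>"
    unfolding eventually_at_right_field by blast
  obtain q where "q \<in> \<rat>" "s < q" "q < min b v"
    using Rats_dense_in_real[of s "min b v"] b(1) s(2) by auto
  then show ?thesis
    using b(2) by (intro bexI[of _ q]) auto
qed

text \<open>A closed bound passes to the limit from the left; \<open>0 \<le> c\<close> covers the
  convention that the left limit at 0 is 0.\<close>

lemma cadlag_abs_left_limit_le:
  assumes f: "cadlag f" and t: "0 \<le> t" and le: "\<And>s. 0 \<le> s \<Longrightarrow> s < t \<Longrightarrow> \<bar>f s\<bar> \<le> c" and c: "0 \<le> c"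
  shows "\<bar>left_limit f t\<bar> \<le> c"
proof (cases "t = 0")
  case True
  then show ?thesis using c by (simp add: left_limit_def)
next
  case False
  with t have t: "0 < t" by simp
  with f obtain l where l: "(f \<longlongrightarrow> l) (at_left t)"
    unfolding cadlag_def by blast
  have "\<bar>l\<bar> \<le> c"
  proof (rule tendsto_upperbound)
    show "((\<lambda>s. \<bar>f s\<bar>) \<longlongrightarrow> \<bar>l\<bar>) (at_left t)"
      using l by (rule tendsto_rabs)
    show "eventually (\<lambda>s. \<bar>f s\<bar> \<le> c) (at_left t)"
      unfolding eventually_at_left_field using t le by (intro exI[of _ 0]) auto
  qed auto
  moreover have "left_limit f t = l"
    using t tendsto_Lim[OF _ l] by (simp add: left_limit_def)
  ultimately show ?thesis by simp
qed

lemma abs_stopped_before_le: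
  assumes f: "cadlag (\<lambda>t. X t \<omega>)" and "0 \<le> t" "0 \<le> c"
    and le: "\<And>s. 0 \<le> s \<Longrightarrow> ennreal s < T \<omega> \<Longrightarrow> \<bar>X s \<omega>\<bar> \<le> c"
  shows "\<bar>stopped_before X T t \<omega>\<bar> \<le> c"
proof (cases "ennreal t < T \<omega>")
  case True
  then show ?thesis using assms by (simp add: stopped_before_def)
next
  case False
  \<comment> \<open>Here \<open>T \<omega> \<le> ennreal t\<close>, so \<open>T \<omega>\<close> is
    finite and \<open>enn2real\<close> returns its true value.\<close>
  then have T: "T \<omega> = ennreal (enn2real (T \<omega>))"
    by (cases "T \<omega>") auto
  have "\<bar>left_limit (\<lambda>s. X s \<omega>) (enn2real (T \<omega>))\<bar> \<le> c"
  proof (rule cadlag_abs_left_limit_le[OF f _ _ \<open>0 \<le> c\<close>])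
    fix s assume "0 \<le> s" "s < enn2real (T \<omega>)"
    then have "ennreal s < ennreal (enn2real (T \<omega>))"
      by (intro ennreal_lessI) auto
    then show "\<bar>X s \<omega>\<bar> \<le> c"
      using \<open>0 \<le> s\<close> T by (intro le) auto
  qed simp
  then show ?thesis
    using False by (simp add: stopped_before_def)
qed

section \<open>Suprema, the L2 norm and Chebyshev's inequality\<close>

lemma less_SUP_abs_iff:
  fixes f :: "'b \<Rightarrow> real"
  assumes "0 \<le> c"
  shows "ennreal c < (SUP s\<in>A. ennreal \<bar>f s\<bar>) \<longleftrightarrow> (\<exists>s\<in>A. c < \<bar>f s\<bar>)"
  using assms by (simp add: less_SUP_iff ennreal_less_iff)

lemma (in prob_space) L2_norm_le_const:
  assumes "\<And>\<omega>. \<omega> \<in> space M \<Longrightarrow> Y \<omega> \<le> ennreal c" "0 \<le> c"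
  shows "L2_norm M Y \<le> ennreal c"
proof -
  have "(\<integral>\<^sup>+\<omega>. (Y \<omega>)\<^sup>2 \<partial>M) \<le> (\<integral>\<^sup>+\<omega>. ennreal (c\<^sup>2) \<partial>M)"
    using assms by (intro nn_integral_mono) (auto simp flip: ennreal_power intro: power_mono)
  also have "\<dots> = ennreal (c\<^sup>2)"
    by (simp add: emeasure_space_1)
  finally have I: "(\<integral>\<^sup>+\<omega>. (Y \<omega>)\<^sup>2 \<partial>M) \<le> ennreal (c\<^sup>2)" .
  then obtain x where x: "0 \<le> x" "(\<integral>\<^sup>+\<omega>. (Y \<omega>)\<^sup>2 \<partial>M) = ennreal x"
    by (cases "\<integral>\<^sup>+\<omega>. (Y \<omega>)\<^sup>2 \<partial>M") (auto simp: top_unique)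
  with I have "sqrt x \<le> c"
    using assms(2) by (intro real_le_lsqrt) auto
  with x show ?thesis
    by (simp add: L2_norm_def ennreal_leI)
qed

text \<open>Integrate the pointwise bound of \<open>c\<^sup>2\<close> times the indicator of
  \<open>A\<close> by the square of \<open>Y\<close>, then take roots. If the integral of the square
  is infinite, so is the norm.\<close>

lemma (in finite_measure) Chebyshev_L2_norm:
  assumes A: "A \<in> sets M" and le: "\<And>\<omega>. \<omega> \<in> A \<Longrightarrow> ennreal c \<le> Y \<omega>" and c: "0 \<le> c"
  shows "ennreal (c * sqrt (measure M A)) \<le> L2_norm M Y"
proof (cases "\<integral>\<^sup>+\<omega>. (Y \<omega>)\<^sup>2 \<partial>M")
  case (real x)
  have "ennreal (c\<^sup>2 * measure M A) = (\<integral>\<^sup>+\<omega>. ennreal (c\<^sup>2) * indicator A \<omega> \<partial>M)"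
    using A c by (simp add: nn_integral_cmult_indicator emeasure_eq_measure ennreal_mult)
  also have "\<dots> \<le> (\<integral>\<^sup>+\<omega>. (Y \<omega>)\<^sup>2 \<partial>M)"
    using le c by (intro nn_integral_mono)
      (auto simp flip: ennreal_power intro: power_mono split: split_indicator)
  finally have "c\<^sup>2 * measure M A \<le> x"
    using real by simp
  then have "sqrt (c\<^sup>2 * measure M A) \<le> sqrt x"
    by simp
  then have "c * sqrt (measure M A) \<le> sqrt x"
    using c by (simp add: real_sqrt_mult)
  with real show ?thesis
    by (simp add: L2_norm_def ennreal_leI)
qed (simp add: L2_norm_def)

lemma ucp_tendsto_subseq:
  assumes "ucp_tendsto M H K" "strict_mono r"
  shows "ucp_tendsto M (\<lambda>l. H (r l)) K"
  unfolding ucp_tendsto_def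
proof (intro allI impI)
  fix t \<epsilon> :: real assume "t > 0" "\<epsilon> > 0"
  then have "(\<lambda>n. measure M {\<omega>\<in>space M. ennreal \<epsilon> < (SUP s\<in>{0..t}. ennreal \<bar>H n s \<omega> - K s \<omega>\<bar>)})
    \<longlonglongrightarrow> 0"
    using assms(1) unfolding ucp_tendsto_def by blast
  from LIMSEQ_subseq_LIMSEQ[OF this assms(2)]
  show "(\<lambda>n. measure M {\<omega>\<in>space M. ennreal \<epsilon> <
    (SUP s\<in>{0..t}. ennreal \<bar>H (r n) s \<omega> - K s \<omega>\<bar>)}) \<longlonglongrightarrow> 0"
    by (simp add: o_def)
qed

text \<open>The infimum runs over the whole tail \<open>l \<ge> m\<close>, so that one time controls
  all these processes at once and grows with \<open>m\<close>. If nothing ever exceeds, the infimum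
  of the empty set in \<open>ennreal\<close> is infinity.\<close>

definition first_exceedance :: "(nat \<Rightarrow> real \<Rightarrow> 'a \<Rightarrow> real) \<Rightarrow> (nat \<Rightarrow> real) \<Rightarrow> nat \<Rightarrow> 'a \<Rightarrow> ennreal" where
  "first_exceedance X c m \<omega> = Inf {ennreal t | t. 0 \<le> t \<and> (\<exists>l\<ge>m. c l < \<bar>X l t \<omega>\<bar>)}"

text \<open>An infimum lies strictly below \<open>v\<close> exactly when some member does. The weak
  inequality has no such witness, because the infimum need not be attained.\<close>

lemma first_exceedance_less_iff:
  assumes "0 \<le> v"
  shows "first_exceedance X c m \<omega> < ennreal v \<longleftrightarrow> (\<exists>t\<ge>0. t < v \<and> (\<exists>l\<ge>m. c l < \<bar>X l t \<omega>\<bar>))"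
proof -
  have "first_exceedance X c m \<omega> < ennreal v \<longleftrightarrow>
      (\<exists>t. ennreal t < ennreal v \<and> 0 \<le> t \<and> (\<exists>l\<ge>m. c l < \<bar>X l t \<omega>\<bar>))"
    unfolding first_exceedance_def Inf_less_iff by blast
  then show ?thesis
    using assms by (auto simp: ennreal_less_iff)
qed

lemma incseq_first_exceedance: "incseq (\<lambda>m. first_exceedance X c m \<omega>)"
  unfolding first_exceedance_def by (intro monoI Inf_superset_mono) (blast intro: order_trans)

lemma abs_le_before_first_exceedance:
  assumes "ennreal t < first_exceedance X c m \<omega>" "0 \<le> t" "m \<le> l"
  shows "\<bar>X l t \<omega>\<bar> \<le> c l"
proof (rule ccontr)
  assume "\<not> \<bar>X l t \<omega>\<bar> \<le> c l"
  then have "first_exceedance X c m \<omega> \<le> ennreal t"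
    unfolding first_exceedance_def using assms(2,3) by (intro Inf_lower) force
  with assms(1) show False by simp
qed

section \<open>Measurability of suprema and of exceedance times\<close>

context stochastic_basis
begin

lemma space_F: "0 \<le> t \<Longrightarrow> space (F t) = space M"
  using subalgebra_F by (simp add: subalgebra_def)

lemma measurable_F_mono:
  assumes "0 \<le> s" "s \<le> t" "f \<in> borel_measurable (F s)"
  shows "f \<in> borel_measurable (F t)"
proof -
  have "subalgebra (F t) (F s)"
    using assms space_F[of s] space_F[of t] F_mono[of s t] by (simp add: subalgebra_def)
  then show ?thesis
    using assms(3) by (rule measurable_from_subalg)
qed

lemma adapted_cadlagD:
  assumes "X \<in> adapted_cadlag M F"
  shows "0 \<le> t \<Longrightarrow> X t \<in> borel_measurable (F t)"
    and "0 \<le> t \<Longrightarrow> X t \<in> borel_measurable M"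
    and "\<omega> \<in> space M \<Longrightarrow> cadlag (\<lambda>t. X t \<omega>)"
  using assms measurable_from_subalg[OF subalgebra_F] by (auto simp: adapted_cadlag_def)

lemma adapted_cadlag_diff:
  assumes "X \<in> adapted_cadlag M F" "Y \<in> adapted_cadlag M F"
  shows "(\<lambda>t \<omega>. X t \<omega> - Y t \<omega>) \<in> adapted_cadlag M F"
  using assms cadlag_diff unfolding adapted_cadlag_def by (auto intro!: borel_measurable_diff)

lemma sets_sup_exceeds:
  assumes X: "X \<in> adapted_cadlag M F" and "0 \<le> c" "0 \<le> t"
  shows "{\<omega>\<in>space M. ennreal c < (SUP s\<in>{0..t}. ennreal \<bar>X s \<omega>\<bar>)} \<in> sets M"
proof -
  \<comment> \<open>An exceedance before \<open>t\<close> moves to a rational time still before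
    \<open>t\<close>; one at \<open>t\<close> has no room on its right inside the interval, so
    \<open>t\<close> joins the countable set explicitly.\<close>
  have *: "(\<exists>s\<in>{0..t}. c < \<bar>X s \<omega>\<bar>) \<longleftrightarrow> (\<exists>s\<in>insert t (\<rat> \<inter> {0..t}). c < \<bar>X s \<omega>\<bar>)"
    if \<omega>: "\<omega> \<in> space M" for \<omega>
  proof
    assume "\<exists>s\<in>{0..t}. c < \<bar>X s \<omega>\<bar>"
    then obtain s where s: "0 \<le> s" "s \<le> t" "c < \<bar>X s \<omega>\<bar>"
      by auto
    show "\<exists>s\<in>insert t (\<rat> \<inter> {0..t}). c < \<bar>X s \<omega>\<bar>"
    proof (cases "s = t")
      case False
      with s have "s < t" by simp
      from cadlag_exceeds_at_rational[OF adapted_cadlagD(3)[OF X \<omega>] s(1) this s(3)]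
      show ?thesis using s(1) by force
    qed (use s in auto)
  qed (use \<open>0 \<le> t\<close> in auto)
  have "countable (insert t (\<rat> \<inter> {0..t}))"
    by (simp add: countable_rat)
  moreover have [measurable]: "X s \<in> borel_measurable M" if "s \<in> insert t (\<rat> \<inter> {0..t})" for s
    using that \<open>0 \<le> t\<close> adapted_cadlagD(2)[OF X] by auto
  ultimately have "{\<omega>\<in>space M. \<exists>s\<in>insert t (\<rat> \<inter> {0..t}). c < \<bar>X s \<omega>\<bar>} \<in> sets M"
    by (intro sets.sets_Collect_countable_Ex') measurable
  then show ?thesis
    using * by (simp add: less_SUP_abs_iff[OF \<open>0 \<le> c\<close>] cong: conj_cong)
qed

text \<open>For each \<open>u > t\<close>, the event that the time is at most \<open>t\<close> is a
  countable intersection of events that it is less than \<open>v n\<close>, with \<open>v n\<close>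
  tending to \<open>t\<close> from above within (t, u]. Each of these is a countable union over
  rational times before \<open>u\<close>, hence in \<open>F u\<close>. Right-continuity of the
  filtration then yields \<open>F t\<close>.\<close>

lemma stopping_time_first_exceedance:
  assumes X: "\<And>l. X l \<in> adapted_cadlag M F"
  shows "extended_stopping_time F (first_exceedance X c m)"
  unfolding extended_stopping_time_def
proof (intro allI impI)
  fix t :: real assume t: "0 \<le> t"
  have "{\<omega>\<in>space M. first_exceedance X c m \<omega> \<le> ennreal t} \<in> sets (F u)" if u: "t < u" for u
  proof -
    define v where "v n = t + (u - t) / Suc n" for n
    have v: "t < v n" "v n \<le> u" for n
      using u divide_left_mono[of 1 "real (Suc n)" "u - t"] by (auto simp: v_def)
    have v_lim: "v \<longlonglongrightarrow> t"
      unfolding v_def by real_asymp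
    have v0: "0 \<le> v n" for n
      using v(1)[of n] t by simp
    \<comment> \<open>Times in \<open>Q n\<close> lie below \<open>v n \<le> u\<close>, so the
      values of the processes there are \<open>F u\<close>-measurable.\<close>
    define Q where "Q n = \<rat> \<inter> {0..<v n}" for n
    have less: "first_exceedance X c m \<omega> < ennreal (v n) \<longleftrightarrow> (\<exists>q\<in>Q n. \<exists>l\<in>{m..}. c l < \<bar>X l q \<omega>\<bar>)"
      if \<omega>: "\<omega> \<in> space M" for \<omega> n
    proof -
      have "\<exists>q\<in>Q n. \<exists>l\<in>{m..}. c l < \<bar>X l q \<omega>\<bar>"
        if s: "0 \<le> s" "s < v n" "m \<le> l" "c l < \<bar>X l s \<omega>\<bar>" for s l
        using cadlag_exceeds_at_rational[OF adapted_cadlagD(3)[OF X \<omega>] s(1,2,4)] s(1,3)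
        by (force simp: Q_def)
      then show ?thesis
        unfolding first_exceedance_less_iff[OF v0] by (auto simp: Q_def)
    qed
    have "first_exceedance X c m \<omega> \<le> ennreal t \<longleftrightarrow>
        (\<forall>n. \<exists>q\<in>Q n. \<exists>l\<in>{m..}. c l < \<bar>X l q \<omega>\<bar>)" if \<omega>: "\<omega> \<in> space M" for \<omega>
      unfolding less[OF \<omega>, symmetric]
    proof
      assume "first_exceedance X c m \<omega> \<le> ennreal t"
      then show "\<forall>n. first_exceedance X c m \<omega> < ennreal (v n)"
        using v(1) t by (meson ennreal_lessI le_less_trans)
    next
      assume "\<forall>n. first_exceedance X c m \<omega> < ennreal (v n)"
      moreover have "(\<lambda>n. ennreal (v n)) \<longlonglongrightarrow> ennreal t"
        using v_lim by (rule tendsto_ennrealI)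
      ultimately show "first_exceedance X c m \<omega> \<le> ennreal t"
        by (intro LIMSEQ_le_const) (auto intro: less_imp_le)
    qed
    moreover have "{\<omega>\<in>space (F u). \<forall>n. \<exists>q\<in>Q n. \<exists>l\<in>{m..}. c l < \<bar>X l q \<omega>\<bar>} \<in> sets (F u)"
    proof (intro sets.sets_Collect_countable_All sets.sets_Collect_countable_Ex')
      fix n q l assume "q \<in> Q n"
      then have [measurable]: "X l q \<in> borel_measurable (F u)"
        using v(2)[of n] by (intro measurable_F_mono[OF _ _ adapted_cadlagD(1)[OF X]]) (auto simp: Q_def)
      show "{\<omega> \<in> space (F u). c l < \<bar>X l q \<omega>\<bar>} \<in> sets (F u)"
        by measurable
    qed (auto simp: Q_def countable_rat)
    moreover have "space (F u) = space M"
      using t u by (intro space_F) simp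
    ultimately show ?thesis
      by (simp cong: conj_cong)
  qed
  then have "{\<omega>\<in>space M. first_exceedance X c m \<omega> \<le> ennreal t} \<in> sets (F t)"
    using F_right_continuous[OF t] by blast
  then show "Measurable.pred (F t) (\<lambda>\<omega>. first_exceedance X c m \<omega> \<le> ennreal t)"
    by (simp add: pred_def space_F[OF t])
qed

lemma S2_norm_stopped_before_first_exceedance_le:
  assumes X: "\<And>l. X l \<in> adapted_cadlag M F" and "m \<le> l" "0 \<le> c l"
  shows "S2_norm M (stopped_before (X l) (first_exceedance X c m)) \<le> ennreal (c l)"
  unfolding S2_norm_def
proof (intro L2_norm_le_const SUP_least ennreal_leI)
  fix \<omega> and t :: real assume "\<omega> \<in> space M" "t \<in> {0..}"
  then show "\<bar>stopped_before (X l) (first_exceedance X c m) t \<omega>\<bar> \<le> c l"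
    using assms
    by (intro abs_stopped_before_le adapted_cadlagD(3) abs_le_before_first_exceedance) auto
qed (use assms in auto)

section \<open>From ucp convergence to pre-local convergence\<close>

lemma prelocal_S2_tendsto_if_summable:
  assumes H: "\<And>l. H l \<in> adapted_cadlag M F" and K: "K \<in> adapted_cadlag M F"
    and summable: "summable (\<lambda>l. measure M {\<omega>\<in>space M.
      ennreal (c l) < (SUP s\<in>{0..real l}. ennreal \<bar>H l s \<omega> - K s \<omega>\<bar>)})"
    and c: "\<And>l. 0 \<le> c l" "c \<longlonglongrightarrow> 0"
  shows "prelocal_S2_tendsto M F H K"
proof -
  define X where "X l t \<omega> = H l t \<omega> - K t \<omega>" for l t \<omega>
  define T where "T = first_exceedance X c"
  have X: "X l \<in> adapted_cadlag M F" for l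
    unfolding X_def using H K by (rule adapted_cadlag_diff)
  have "AE \<omega> in M. eventually (\<lambda>l. \<omega> \<in> space M -
      {\<omega>\<in>space M. ennreal (c l) < (SUP s\<in>{0..real l}. ennreal \<bar>X l s \<omega>\<bar>)}) sequentially"
    using summable unfolding X_def[symmetric]
    by (intro borel_cantelli_AE1 sets_sup_exceeds X c) (auto simp: emeasure_eq_measure)
  then have "AE \<omega> in M. (\<lambda>m. T m \<omega>) \<longlonglongrightarrow> \<infinity>"
  proof eventually_elim
    case (elim \<omega>)
    then obtain L where "\<forall>l\<ge>L. \<forall>s\<in>{0..real l}. \<bar>X l s \<omega>\<bar> \<le> c l"
      unfolding eventually_sequentially by (auto simp: less_SUP_abs_iff[OF c(1)] not_less)
    then have L: "L \<le> l \<Longrightarrow> 0 \<le> s \<Longrightarrow> s \<le> real l \<Longrightarrow> \<bar>X l s \<omega>\<bar> \<le> c l" for l s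
      by auto
    \<comment> \<open>The horizon grows with the index: an exceedance before time \<open>m\<close>
      by some \<open>X l\<close> with \<open>l \<ge> m \<ge> L\<close> would fall in [0, l], where
      \<open>c l\<close> already bounds that process.\<close>
    have "ennreal (real m) \<le> T m \<omega>" if "L \<le> m" for m
    proof (rule ccontr)
      assume "\<not> ennreal (real m) \<le> T m \<omega>"
      then obtain t l where "0 \<le> t" "t < real m" "m \<le> l" "c l < \<bar>X l t \<omega>\<bar>"
        unfolding T_def not_le by (auto simp: first_exceedance_less_iff)
      with L[of l t] \<open>L \<le> m\<close> show False by auto
    qed
    then have "eventually (\<lambda>m. ennreal (real m) \<le> T m \<omega>) sequentially"
      by (auto simp: eventually_sequentially)
    moreover have "(\<lambda>m. ennreal (real m)) \<longlonglongrightarrow> \<infinity>"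
      by (simp add: ennreal_of_nat_eq_real_of_nat[symmetric] of_nat_tendsto_top_ennreal)
    ultimately show ?case
      by (intro tendsto_sandwich[of "\<lambda>m. ennreal (real m)" "\<lambda>m. T m \<omega>" _ "\<lambda>_. \<infinity>"]) auto
  qed
  moreover have "(\<lambda>l. S2_norm M (stopped_before (X l) (T m))) \<longlonglongrightarrow> 0" for m
  proof (rule tendsto_sandwich[OF _ _ tendsto_const])
    \<comment> \<open>For fixed \<open>m\<close> the bound \<open>c l\<close> holds from
      \<open>l = m\<close> on, and the limit ignores the earlier indices.\<close>
    show "eventually (\<lambda>l. S2_norm M (stopped_before (X l) (T m)) \<le> ennreal (c l)) sequentially"
      using eventually_ge_at_top[of m]
      by eventually_elim (simp add: T_def S2_norm_stopped_before_first_exceedance_le X c(1))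
    show "(\<lambda>l. ennreal (c l)) \<longlonglongrightarrow> 0"
      using tendsto_ennrealI[OF c(2)] by simp
  qed auto
  ultimately show ?thesis
    unfolding prelocal_S2_tendsto_def X_def[symmetric]
    using stopping_time_first_exceedance[OF X] incseq_first_exceedance
    by (intro exI[of _ T]) (auto simp: T_def)
qed

text \<open>The sequence of powers of 1/2 serves twice: as thresholds tending to 0, and as summable
  bounds for the exceedance probabilities.\<close>

lemma ucp_tendsto_imp_prelocal_subseq:
  assumes H: "\<And>n. H n \<in> adapted_cadlag M F" and K: "K \<in> adapted_cadlag M F"
    and ucp: "ucp_tendsto M H K"
  obtains s :: "nat \<Rightarrow> nat" where "strict_mono s" "prelocal_S2_tendsto M F (\<lambda>l. H (s l)) K"
proof -
  define p where "p l t n = measure M {\<omega>\<in>space M.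
    ennreal ((1/2)^l) < (SUP s\<in>{0..t}. ennreal \<bar>H n s \<omega> - K s \<omega>\<bar>)}" for l t n
  have "eventually (\<lambda>n. p l (real l) n \<le> (1/2)^l) sequentially" for l
  proof -
    \<comment> \<open>The horizon \<open>real l\<close> vanishes at \<open>l = 0\<close>, whereas
      ucp convergence speaks of positive horizons. Hence the detour through \<open>Suc l\<close>; a
      shorter horizon only lowers the probability.\<close>
    have "p l (real (Suc l)) \<longlonglongrightarrow> 0"
      using ucp unfolding ucp_tendsto_def p_def by force
    then have "eventually (\<lambda>n. p l (real (Suc l)) n < (1/2)^l) sequentially"
      by (rule order_tendstoD) simp
    moreover have "p l (real l) n \<le> p l (real (Suc l)) n" for n
      unfolding p_def using sets_sup_exceeds[OF adapted_cadlag_diff[OF H K], of "(1/2)^l" "real (Suc l)"]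
      by (intro finite_measure_mono) (auto simp: less_SUP_abs_iff)
    ultimately show ?thesis
      by (auto elim!: eventually_mono intro: order_trans less_imp_le)
  qed
  then obtain s :: "nat \<Rightarrow> nat" where s: "strict_mono s" "\<And>l. p l (real l) (s l) \<le> (1/2)^l"
    using strict_mono_choice[of "\<lambda>l n. p l (real l) n \<le> (1/2)^l"] by blast
  have "summable (\<lambda>l. p l (real l) (s l))"
    by (rule summable_comparison_test'[of "\<lambda>l. (1/2)^l" 0]) (use s(2) in \<open>auto simp: p_def\<close>)
  then have "prelocal_S2_tendsto M F (\<lambda>l. H (s l)) K"
    unfolding p_def
    by (intro prelocal_S2_tendsto_if_summable[where c = "\<lambda>l. (1/2)^l"] H K) (auto intro: LIMSEQ_power_zero)
  with s(1) show ?thesis by (rule that)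
qed

section \<open>From pre-local convergence back to ucp convergence\<close>

lemma prelocal_S2_tendsto_imp_ucp_tendsto:
  assumes H: "\<And>n. H n \<in> adapted_cadlag M F" and K: "K \<in> adapted_cadlag M F"
    and prelocal: "prelocal_S2_tendsto M F H K"
  shows "ucp_tendsto M H K"
  unfolding ucp_tendsto_def
proof (intro allI impI)
  fix t \<epsilon> :: real assume t: "0 < t" and \<epsilon>: "0 < \<epsilon>"
  define X where "X l t \<omega> = H l t \<omega> - K t \<omega>" for l t \<omega>
  have X: "X l \<in> adapted_cadlag M F" for l
    unfolding X_def using H K by (rule adapted_cadlag_diff)
  obtain T where T: "\<And>m. extended_stopping_time F (T m)"
      "\<And>\<omega>. \<omega> \<in> space M \<Longrightarrow> incseq (\<lambda>m. T m \<omega>)" "AE \<omega> in M. (\<lambda>m. T m \<omega>) \<longlonglongrightarrow> \<infinity>"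
      "\<And>m. (\<lambda>l. S2_norm M (stopped_before (X l) (T m))) \<longlonglongrightarrow> 0"
    using prelocal unfolding prelocal_S2_tendsto_def X_def[symmetric] by blast
  define A where "A l = {\<omega>\<in>space M. ennreal \<epsilon> < (SUP s\<in>{0..t}. ennreal \<bar>X l s \<omega>\<bar>)}" for l
  define B where "B m = {\<omega>\<in>space M. T m \<omega> \<le> ennreal t}" for m
  have A: "A l \<in> sets M" for l
    unfolding A_def using X \<epsilon> t by (intro sets_sup_exceeds) auto
  have B: "B m \<in> sets M" for m
  proof -
    have "B m \<in> sets (F t)"
      using T(1)[of m] t unfolding extended_stopping_time_def B_def pred_def by (simp add: space_F)
    then show ?thesis
      using subalgebra_F[of t] t by (auto simp: subalgebra_def)
  qed
  \<comment> \<open>The events \<open>B m\<close>, on which stopping may interfere before or at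
    \<open>t\<close>, decrease to a null set because \<open>T m\<close> tends to infinity almost
    surely.\<close>
  have "(\<lambda>m. measure M (B m)) \<longlonglongrightarrow> measure M (\<Inter>m. B m)"
  proof (rule finite_Lim_measure_decseq)
    show "decseq B"
      using T(2) unfolding B_def decseq_def incseq_def by (blast intro: order_trans)
  qed (use B in auto)
  also have "measure M (\<Inter>m. B m) = 0"
  proof -
    have "AE \<omega> in M. \<omega> \<notin> (\<Inter>m. B m)"
      using T(3)
    proof eventually_elim
      case (elim \<omega>)
      then have "eventually (\<lambda>m. ennreal t < T m \<omega>) sequentially"
        by (rule order_tendstoD) simp
      then show ?case
        by (auto simp: B_def eventually_sequentially not_le)
    qed
    then show ?thesis
      using B by (subst prob_eq_0) auto
  qed
  finally have B_lim: "(\<lambda>m. measure M (B m)) \<longlonglongrightarrow> 0" .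
  have A_lim: "(\<lambda>l. measure M (A l - B m)) \<longlonglongrightarrow> 0" for m
  proof -
    have le: "ennreal (\<epsilon> * sqrt (measure M (A l - B m))) \<le>
        S2_norm M (stopped_before (X l) (T m))" for l
      unfolding S2_norm_def
    proof (rule Chebyshev_L2_norm)
      fix \<omega> assume \<omega>: "\<omega> \<in> A l - B m"
      then obtain s where s: "0 \<le> s" "s \<le> t" "\<epsilon> < \<bar>X l s \<omega>\<bar>"
        using less_SUP_abs_iff[of \<epsilon> "\<lambda>s. X l s \<omega>"] \<epsilon> by (auto simp: A_def)
      have "ennreal s \<le> ennreal t"
        using s(2) by (rule ennreal_leI)
      also have "ennreal t < T m \<omega>"
        using \<omega> by (auto simp: A_def B_def)
      \<comment> \<open>Outside \<open>B m\<close> the stopping time lies beyond \<open>t\<close>,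
        so the exceedance at \<open>s \<le> t\<close> survives in the stopped process.\<close>
      finally have "stopped_before (X l) (T m) s \<omega> = X l s \<omega>"
        by (simp add: stopped_before_def)
      then show "ennreal \<epsilon> \<le> (SUP t\<in>{0..}. ennreal \<bar>stopped_before (X l) (T m) t \<omega>\<bar>)"
        using s by (intro SUP_upper2[of s]) (auto intro: ennreal_leI)
    qed (use A B \<epsilon> in auto)
    have "(\<lambda>l. ennreal (\<epsilon> * sqrt (measure M (A l - B m)))) \<longlonglongrightarrow> 0"
      by (rule tendsto_sandwich[OF _ _ tendsto_const T(4)[of m]]) (use le in auto)
    then have "(\<lambda>l. \<epsilon> * sqrt (measure M (A l - B m))) \<longlonglongrightarrow> 0"
      using \<epsilon> by (subst (asm) ennreal_0[symmetric], subst (asm) tendsto_ennreal_iff) auto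
    \<comment> \<open>Dividing by \<open>\<epsilon>\<close> and squaring recovers the probability
      from its root.\<close>
    then have "(\<lambda>l. (\<epsilon> * sqrt (measure M (A l - B m)) / \<epsilon>)\<^sup>2) \<longlonglongrightarrow> (0 / \<epsilon>)\<^sup>2"
      using \<epsilon> by (intro tendsto_intros) auto
    then show ?thesis
      using \<epsilon> by simp
  qed
  have "(\<lambda>l. measure M (A l)) \<longlonglongrightarrow> 0"
  proof (rule LIMSEQ_I)
    fix \<delta> :: real assume \<delta>: "0 < \<delta>"
    \<comment> \<open>The order matters: \<open>m\<close> is fixed first to make \<open>B m\<close>
      small, and only then is \<open>l\<close> taken large, at a rate that may depend on
      \<open>m\<close>.\<close>
    have "eventually (\<lambda>m. measure M (B m) < \<delta> / 2) sequentially"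
      using B_lim by (rule order_tendstoD) (use \<delta> in simp)
    then obtain m where m: "measure M (B m) < \<delta> / 2"
      by (auto simp: eventually_sequentially)
    have "eventually (\<lambda>l. measure M (A l - B m) < \<delta> / 2) sequentially"
      using A_lim by (rule order_tendstoD) (use \<delta> in simp)
    moreover have "measure M (A l) \<le> measure M (A l - B m) + measure M (B m)" for l
    proof -
      have "measure M (A l) \<le> measure M ((A l - B m) \<union> B m)"
        using A B by (intro finite_measure_mono) auto
      also have "\<dots> \<le> measure M (A l - B m) + measure M (B m)"
        using A B by (intro measure_Un_le) auto
      finally show ?thesis .
    qed
    ultimately have "eventually (\<lambda>l. measure M (A l) < \<delta>) sequentially"
      using m by (auto elim!: eventually_mono) (smt (verit) field_sum_of_halves)
    then show "\<exists>no. \<forall>n\<ge>no. norm (measure M (A n) - 0) < \<delta>"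
      by (simp add: eventually_sequentially)
  qed
  then show "(\<lambda>n. measure M {\<omega>\<in>space M. ennreal \<epsilon> <
      (SUP s\<in>{0..t}. ennreal \<bar>H n s \<omega> - K s \<omega>\<bar>)}) \<longlonglongrightarrow> 0"
    by (simp add: A_def X_def)
qed

end

theorem theorem2p2:
  fixes M :: "'a measure" and F :: "real \<Rightarrow> 'a measure"
    and H :: "nat \<Rightarrow> real \<Rightarrow> 'a \<Rightarrow> real" and H_lim :: "real \<Rightarrow> 'a \<Rightarrow> real"
  assumes "stochastic_basis M F"
    and "\<And>n. H n \<in> adapted_cadlag M F"
    and "H_lim \<in> adapted_cadlag M F"
  shows "ucp_tendsto M H H_lim \<longleftrightarrow>
    (\<forall>r :: nat \<Rightarrow> nat. strict_mono r \<longrightarrow>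
      (\<exists>s :: nat \<Rightarrow> nat. strict_mono s \<and> prelocal_S2_tendsto M F (\<lambda>l. H (r (s l))) H_lim))"
proof -
  interpret stochastic_basis M F by fact
  show ?thesis
  proof (intro iffI allI impI)
    fix r :: "nat \<Rightarrow> nat" assume "ucp_tendsto M H H_lim" "strict_mono r"
    then have "ucp_tendsto M (\<lambda>l. H (r l)) H_lim"
      by (rule ucp_tendsto_subseq)
    then obtain s :: "nat \<Rightarrow> nat" where "strict_mono s"
        "prelocal_S2_tendsto M F (\<lambda>l. H (r (s l))) H_lim"
      using ucp_tendsto_imp_prelocal_subseq[of "\<lambda>l. H (r l)" H_lim] assms(2,3) by blast
    then show "\<exists>s :: nat \<Rightarrow> nat. strict_mono s \<and> prelocal_S2_tendsto M F (\<lambda>l. H (r (s l))) H_lim"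
      by blast
  next
    assume *: "\<forall>r :: nat \<Rightarrow> nat. strict_mono r \<longrightarrow>
      (\<exists>s :: nat \<Rightarrow> nat. strict_mono s \<and> prelocal_S2_tendsto M F (\<lambda>l. H (r (s l))) H_lim)"
    show "ucp_tendsto M H H_lim"
      unfolding ucp_tendsto_def
    \<comment> \<open>With \<open>t\<close> and \<open>\<epsilon>\<close> fixed, ucp convergence is
      convergence of one real sequence of probabilities, to which the subsubsequence principle
      applies.\<close>
    proof (intro allI impI, rule tendsto_if_subsubseq_tendsto)
      fix t \<epsilon> :: real and r :: "nat \<Rightarrow> nat" assume "t > 0" "\<epsilon> > 0" "strict_mono r"
      with * obtain s :: "nat \<Rightarrow> nat" where "prelocal_S2_tendsto M F (\<lambda>l. H (r (s l))) H_lim"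
        by blast
      then have "ucp_tendsto M (\<lambda>l. H (r (s l))) H_lim"
        by (rule prelocal_S2_tendsto_imp_ucp_tendsto[rotated 2]) (use assms in auto)
      then show "\<exists>s :: nat \<Rightarrow> nat. (\<lambda>l. measure M {\<omega>\<in>space M. ennreal \<epsilon> <
          (SUP u\<in>{0..t}. ennreal \<bar>H (r (s l)) u \<omega> - H_lim u \<omega>\<bar>)}) \<longlonglongrightarrow> 0"
        using \<open>t > 0\<close> \<open>\<epsilon> > 0\<close> unfolding ucp_tendsto_def by blast
    qed
  qed
qed

end
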